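(* For every formula $F$, if $F$ is provable in $\mathsf{IL}+\mathsf{EM}_1^-$, then $F$ is provable in $\mathsf{IL}+\mathsf{MP}$.
   Context: Formulas of first-order logic are built from atomic formulas and $\bot$ using $\land,\lor,\rightarrow,\forall,\exists$, with $\lnot A:=A\rightarrow\bot$. A propositional formula is quantifier-free; it is negative if $\lor$ does not occur in it. $\mathsf{IL}+\mathsf{MP}$ is intuitionistic first-order natural deduction extended with the scheme $\lnot\lnot\exists\alpha\,P\rightarrow\exists\alpha\,P$ for every propositional formula $P$. $\mathsf{IL}+\mathsf{EM}_1^-$ is intuitionistic first-order natural deduction (including the axiom $\bot\rightarrow P$) extended with: the axioms $\Gamma, P\vdash P$ for negative propositional $P$; the rule $\mathsf{EM}_0$: from $\Gamma,\lnot P\vdash C$ and $\Gamma,P\vdash C$ infer $\Gamma\vdash C$, for $P$ negative propositional and $C$ arbitrary; and the rule $\mathsf{EM}_1^-$: from $\Gamma,\forall\alpha\,P\vdash\exists\beta\,Q$ and $\Gamma,\exists\alpha\,\lnot P\vdash\exists\beta\,Q$ infer $\Gamma\vdash\exists\beta\,Q$, for $P,Q$ negative propositional formulas. *)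

theory Defs imports Main begin

text \<open>A first-order language is given by its function and predicate symbols, each paired with
  an arity; constants are function symbols of arity 0.\<close>

record ('f, 'p) language =
  funs :: "('f \<times> nat) set"
  preds :: "('p \<times> nat) set"

text \<open>Variables are de Bruijn indices, so formulas are identified up to renaming of bound
  variables: \<open>Var n\<close> below \<open>k\<close> quantifiers refers to the \<open>n\<close>-th enclosing quantifier (counted
  from the innermost one) if \<open>n < k\<close>, and to the free variable \<open>n - k\<close> otherwise.\<close>

datatype 'f tm = Var nat | Fun 'f "'f tm list"

datatype ('f, 'p) fm =
    Bot
  | Atom 'p "'f tm list"
  | And "('f, 'p) fm" "('f, 'p) fm"
  | Or "('f, 'p) fm" "('f, 'p) fm"
  | Imp "('f, 'p) fm" "('f, 'p) fm"
  | All "('f, 'p) fm"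
  | Ex "('f, 'p) fm"

abbreviation Neg :: "('f, 'p) fm \<Rightarrow> ('f, 'p) fm" where
  "Neg A \<equiv> Imp A Bot"

primrec wf_tm :: "('f, 'p) language \<Rightarrow> 'f tm \<Rightarrow> bool" where
  "wf_tm L (Var n) \<longleftrightarrow> True"
| "wf_tm L (Fun f ts) \<longleftrightarrow> (f, length ts) \<in> funs L \<and> list_all (wf_tm L) ts"

primrec wf_fm :: "('f, 'p) language \<Rightarrow> ('f, 'p) fm \<Rightarrow> bool" where
  "wf_fm L Bot \<longleftrightarrow> True"
| "wf_fm L (Atom p ts) \<longleftrightarrow> (p, length ts) \<in> preds L \<and> list_all (wf_tm L) ts"
| "wf_fm L (And A B) \<longleftrightarrow> wf_fm L A \<and> wf_fm L B"
| "wf_fm L (Or A B) \<longleftrightarrow> wf_fm L A \<and> wf_fm L B"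
| "wf_fm L (Imp A B) \<longleftrightarrow> wf_fm L A \<and> wf_fm L B"
| "wf_fm L (All A) \<longleftrightarrow> wf_fm L A"
| "wf_fm L (Ex A) \<longleftrightarrow> wf_fm L A"

primrec propositional :: "('f, 'p) fm \<Rightarrow> bool" where
  "propositional Bot \<longleftrightarrow> True"
| "propositional (Atom p ts) \<longleftrightarrow> True"
| "propositional (And A B) \<longleftrightarrow> propositional A \<and> propositional B"
| "propositional (Or A B) \<longleftrightarrow> propositional A \<and> propositional B"
| "propositional (Imp A B) \<longleftrightarrow> propositional A \<and> propositional B"
| "propositional (All A) \<longleftrightarrow> False"
| "propositional (Ex A) \<longleftrightarrow> False"

primrec or_free :: "('f, 'p) fm \<Rightarrow> bool" where
  "or_free Bot \<longleftrightarrow> True"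
| "or_free (Atom p ts) \<longleftrightarrow> True"
| "or_free (And A B) \<longleftrightarrow> or_free A \<and> or_free B"
| "or_free (Or A B) \<longleftrightarrow> False"
| "or_free (Imp A B) \<longleftrightarrow> or_free A \<and> or_free B"
| "or_free (All A) \<longleftrightarrow> or_free A"
| "or_free (Ex A) \<longleftrightarrow> or_free A"

definition neg_propositional :: "('f, 'p) fm \<Rightarrow> bool" where
  "neg_propositional P \<longleftrightarrow> propositional P \<and> or_free P"

text \<open>Simultaneous capture-avoiding substitution; \<open>up s\<close> is the substitution \<open>s\<close> moved under
  one quantifier.\<close>

primrec subst_tm :: "(nat \<Rightarrow> 'f tm) \<Rightarrow> 'f tm \<Rightarrow> 'f tm" where
  "subst_tm s (Var n) = s n"
| "subst_tm s (Fun f ts) = Fun f (map (subst_tm s) ts)"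

definition up :: "(nat \<Rightarrow> 'f tm) \<Rightarrow> nat \<Rightarrow> 'f tm" where
  "up s = case_nat (Var 0) (\<lambda>n. subst_tm (\<lambda>m. Var (Suc m)) (s n))"

primrec subst_fm :: "(nat \<Rightarrow> 'f tm) \<Rightarrow> ('f, 'p) fm \<Rightarrow> ('f, 'p) fm" where
  "subst_fm s Bot = Bot"
| "subst_fm s (Atom p ts) = Atom p (map (subst_tm s) ts)"
| "subst_fm s (And A B) = And (subst_fm s A) (subst_fm s B)"
| "subst_fm s (Or A B) = Or (subst_fm s A) (subst_fm s B)"
| "subst_fm s (Imp A B) = Imp (subst_fm s A) (subst_fm s B)"
| "subst_fm s (All A) = All (subst_fm (up s) A)"
| "subst_fm s (Ex A) = Ex (subst_fm (up s) A)"

text \<open>For the body \<open>A\<close> of a quantified formula, \<open>inst A t\<close> replaces the bound variable by \<open>t\<close>.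
  \<open>shift A\<close> renumbers the free variables of \<open>A\<close> so that \<open>Var 0\<close> becomes fresh; this expresses
  the eigenvariable condition in the rules \<open>allI\<close> and \<open>exE\<close> below.\<close>

definition inst :: "('f, 'p) fm \<Rightarrow> 'f tm \<Rightarrow> ('f, 'p) fm" where
  "inst A t = subst_fm (case_nat t Var) A"

definition shift :: "('f, 'p) fm \<Rightarrow> ('f, 'p) fm" where
  "shift A = subst_fm (\<lambda>n. Var (Suc n)) A"

type_synonym ('f, 'p) sequent = "('f, 'p) fm list \<times> ('f, 'p) fm"

type_synonym ('f, 'p) rules = "(('f, 'p) sequent list \<times> ('f, 'p) sequent) set"

text \<open>\<open>IL L R \<Gamma> A\<close>: the sequent \<open>\<Gamma> \<turnstile> A\<close> is derivable in intuitionistic natural deduction over the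
  language \<open>L\<close>, extended by the rule instances \<open>R\<close> (lists of premises with a conclusion; axioms
  have no premises). The well-formedness conditions ensure that all sequents of a derivation
  consist of formulas of \<open>L\<close>.\<close>

inductive IL :: "('f, 'p) language \<Rightarrow> ('f, 'p) rules \<Rightarrow> ('f, 'p) fm list \<Rightarrow> ('f, 'p) fm \<Rightarrow> bool"
  for L :: "('f, 'p) language" and R :: "('f, 'p) rules" where
  hyp: "list_all (wf_fm L) \<Gamma> \<Longrightarrow> A \<in> set \<Gamma> \<Longrightarrow> IL L R \<Gamma> A"
| bot: "list_all (wf_fm L) \<Gamma> \<Longrightarrow> wf_fm L A \<Longrightarrow> IL L R \<Gamma> (Imp Bot A)"
| andI: "IL L R \<Gamma> A \<Longrightarrow> IL L R \<Gamma> B \<Longrightarrow> IL L R \<Gamma> (And A B)"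
| andE1: "IL L R \<Gamma> (And A B) \<Longrightarrow> IL L R \<Gamma> A"
| andE2: "IL L R \<Gamma> (And A B) \<Longrightarrow> IL L R \<Gamma> B"
| orI1: "IL L R \<Gamma> A \<Longrightarrow> wf_fm L B \<Longrightarrow> IL L R \<Gamma> (Or A B)"
| orI2: "IL L R \<Gamma> B \<Longrightarrow> wf_fm L A \<Longrightarrow> IL L R \<Gamma> (Or A B)"
| orE: "IL L R \<Gamma> (Or A B) \<Longrightarrow> IL L R (A # \<Gamma>) C \<Longrightarrow> IL L R (B # \<Gamma>) C \<Longrightarrow> IL L R \<Gamma> C"
| impI: "IL L R (A # \<Gamma>) B \<Longrightarrow> IL L R \<Gamma> (Imp A B)"
| impE: "IL L R \<Gamma> (Imp A B) \<Longrightarrow> IL L R \<Gamma> A \<Longrightarrow> IL L R \<Gamma> B"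
| allI: "IL L R (map shift \<Gamma>) A \<Longrightarrow> IL L R \<Gamma> (All A)"
| allE: "IL L R \<Gamma> (All A) \<Longrightarrow> wf_tm L t \<Longrightarrow> IL L R \<Gamma> (inst A t)"
| exI: "IL L R \<Gamma> (inst A t) \<Longrightarrow> wf_tm L t \<Longrightarrow> IL L R \<Gamma> (Ex A)"
| exE: "IL L R \<Gamma> (Ex A) \<Longrightarrow> IL L R (A # map shift \<Gamma>) (shift C) \<Longrightarrow> IL L R \<Gamma> C"
| ext: "(ps, \<Gamma>, C) \<in> R \<Longrightarrow> (\<And>\<Delta> B. (\<Delta>, B) \<in> set ps \<Longrightarrow> IL L R \<Delta> B) \<Longrightarrow>
    list_all (wf_fm L) \<Gamma> \<Longrightarrow> wf_fm L C \<Longrightarrow> IL L R \<Gamma> C"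

definition MP_rules :: "('f, 'p) rules" where
  "MP_rules = {([], \<Gamma>, Imp (Neg (Neg (Ex P))) (Ex P)) | \<Gamma> P. propositional P}"

definition neg_axioms :: "('f, 'p) rules" where
  "neg_axioms = {([], P # \<Gamma>, P) | \<Gamma> P. neg_propositional P}"

definition EM0_rules :: "('f, 'p) rules" where
  "EM0_rules = {([(Neg P # \<Gamma>, C), (P # \<Gamma>, C)], \<Gamma>, C) | \<Gamma> P C. neg_propositional P}"

text \<open>Here \<open>P\<close> and \<open>Q\<close> are bodies of quantified formulas: \<open>Var 0\<close> plays the role of \<open>\<alpha>\<close> in \<open>P\<close>
  and of \<open>\<beta>\<close> in \<open>Q\<close>.\<close>

definition EM1_neg_rules :: "('f, 'p) rules" where
  "EM1_neg_rules = {([(All P # \<Gamma>, Ex Q), (Ex (Neg P) # \<Gamma>, Ex Q)], \<Gamma>, Ex Q) | \<Gamma> P Q.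
    neg_propositional P \<and> neg_propositional Q}"

definition provable_IL_MP :: "('f, 'p) language \<Rightarrow> ('f, 'p) fm \<Rightarrow> bool" where
  "provable_IL_MP L F \<longleftrightarrow> IL L MP_rules [] F"

definition provable_IL_EM1_neg :: "('f, 'p) language \<Rightarrow> ('f, 'p) fm \<Rightarrow> bool" where
  "provable_IL_EM1_neg L F \<longleftrightarrow> IL L (neg_axioms \<union> EM0_rules \<union> EM1_neg_rules) [] F"

end

theory Submission imports Defs begin

text \<open>Markov's principle for \<open>P \<or> \<not> P\<close> under a vacuous quantifier makes propositional formulas
  decidable, because \<open>\<not>\<not>(P \<or> \<not> P)\<close> is intuitionistically valid; this gives \<open>EM\<^sub>0\<close>. For
  \<open>EM\<^sub>1\<^sup>-\<close>, Markov's principle reduces the goal \<open>\<exists>\<beta> Q\<close> to \<open>\<not>\<not>\<exists>\<beta> Q\<close>. If \<open>\<not>\<exists>\<beta> Q\<close>, then the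
  second premise gives \<open>\<not>\<exists>\<alpha> \<not>P\<close>, so \<open>\<forall>\<alpha> P\<close> by decidability of \<open>P\<close>, and the first premise yields
  a contradiction.\<close>

lemma wf_subst_tm: "(\<And>n. wf_tm L (s n)) \<Longrightarrow> wf_tm L t \<Longrightarrow> wf_tm L (subst_tm s t)"
  by (induction t) (auto simp: list_all_iff)

text \<open>Substitution replaces variables only, so every function symbol of \<open>t\<close>
  survives with its arity, whatever \<open>s\<close> is.\<close>

lemma wf_subst_tmD: "wf_tm L (subst_tm s t) \<Longrightarrow> wf_tm L t"
  by (induction t) (auto simp: list_all_iff)

lemma wf_up: "(\<And>n. wf_tm L (s n)) \<Longrightarrow> wf_tm L (up s n)"
  by (auto simp: up_def wf_subst_tm split: nat.split)

lemma wf_subst_fm: "(\<And>n. wf_tm L (s n)) \<Longrightarrow> wf_fm L A \<Longrightarrow> wf_fm L (subst_fm s A)"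
  by (induction A arbitrary: s) (auto simp: list_all_iff wf_subst_tm wf_up)

lemma wf_subst_fmD: "wf_fm L (subst_fm s A) \<Longrightarrow> wf_fm L A"
  by (induction A arbitrary: s) (auto simp: list_all_iff dest: wf_subst_tmD)

lemma wf_shift [simp]: "wf_fm L (shift A) \<longleftrightarrow> wf_fm L A"
  unfolding shift_def by (auto intro: wf_subst_fm dest: wf_subst_fmD)

lemma list_all_wf_shift [simp]: "list_all (wf_fm L) (map shift \<Gamma>) \<longleftrightarrow> list_all (wf_fm L) \<Gamma>"
  by (simp add: list_all_iff)

lemma wf_inst: "wf_fm L A \<Longrightarrow> wf_tm L t \<Longrightarrow> wf_fm L (inst A t)"
  unfolding inst_def by (rule wf_subst_fm) (auto split: nat.split)

lemma wf_instD: "wf_fm L (inst A t) \<Longrightarrow> wf_fm L A"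
  unfolding inst_def by (rule wf_subst_fmD)

lemma IL_wf: "IL L R \<Gamma> A \<Longrightarrow> list_all (wf_fm L) \<Gamma> \<and> wf_fm L A"
  by (induction rule: IL.induct) (auto simp: wf_inst list_all_iff dest: wf_instD)

lemma subst_tm_comp: "subst_tm s (subst_tm r t) = subst_tm (subst_tm s \<circ> r) t"
  by (induction t) auto

lemma subst_tm_Var [simp]: "subst_tm Var t = t"
  by (induction t) (auto simp: map_idI)

text \<open>Without quantifiers a substitution never passes under \<open>up\<close>, so the inverse
  law for terms carries over to the atoms unchanged.\<close>

lemma subst_fm_inverse_propositional:
  assumes "propositional A" and "\<And>n. subst_tm s (r n) = Var n"
  shows "subst_fm s (subst_fm r A) = A"
proof -
  have "subst_tm s \<circ> r = Var" using assms(2) by auto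
  then have "subst_tm s (subst_tm r t) = t" for t by (simp add: subst_tm_comp)
  then show ?thesis using assms(1) by (induction A) (auto simp: map_idI)
qed

lemma propositional_subst [simp]: "propositional (subst_fm s A) \<longleftrightarrow> propositional A"
  by (induction A) auto

lemma inst_shift_propositional: "propositional A \<Longrightarrow> inst (shift A) t = A"
  unfolding inst_def shift_def by (rule subst_fm_inverse_propositional) auto

text \<open>Shifting \<open>Ex A\<close> turns its body into this \<open>up\<close> substitution.
  Instantiating it at \<open>Var 0\<close> identifies the bound variable with the fresh one.\<close>

lemma inst_up_Suc_propositional:
  "propositional A \<Longrightarrow> inst (subst_fm (up (\<lambda>n. Var (Suc n))) A) (Var 0) = A"
  unfolding inst_def
  by (rule subst_fm_inverse_propositional) (auto simp: up_def split: nat.split)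

lemma IL_botE: "IL L R \<Gamma> Bot \<Longrightarrow> wf_fm L A \<Longrightarrow> IL L R \<Gamma> A"
  by (meson IL.impE IL.bot IL_wf)

lemma IL_MP_markov:
  assumes "propositional P" "wf_fm L P" "IL L MP_rules (Neg (Ex P) # \<Gamma>) Bot"
  shows "IL L MP_rules \<Gamma> (Ex P)"
proof (rule IL.impE)
  show "IL L MP_rules \<Gamma> (Neg (Neg (Ex P)))" using assms(3) by (rule IL.impI)
  have "list_all (wf_fm L) \<Gamma>" using IL_wf[OF assms(3)] by simp
  moreover have "([], \<Gamma>, Imp (Neg (Neg (Ex P))) (Ex P)) \<in> MP_rules"
    using assms(1) by (auto simp: MP_rules_def)
  ultimately show "IL L MP_rules \<Gamma> (Imp (Neg (Neg (Ex P))) (Ex P))"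
    using assms(2) by (auto intro: IL.ext)
qed

lemma IL_MP_decidable:
  assumes P: "propositional P" "wf_fm L P" and \<Gamma>: "list_all (wf_fm L) \<Gamma>"
  shows "IL L MP_rules \<Gamma> (Or P (Neg P))"
proof -
  let ?D = "Or P (Neg P)"
  \<comment> \<open>\<open>shift\<close> makes the quantifier vacuous: every instance of
    \<open>shift ?D\<close> is \<open>?D\<close> again.\<close>
  let ?N = "Neg (Ex (shift ?D))"
  have D: "propositional ?D" "wf_fm L ?D" using P by auto
  have contra: "IL L MP_rules \<Delta> Bot"
    if "?N \<in> set \<Delta>" "IL L MP_rules \<Delta> ?D" for \<Delta>
  proof (rule IL.impE)
    show "IL L MP_rules \<Delta> ?N" using that IL_wf by (blast intro: IL.hyp)
    show "IL L MP_rules \<Delta> (Ex (shift ?D))"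
      using that(2) by (intro IL.exI[where t = "Var 0"]) (simp_all only: inst_shift_propositional[OF D(1)] wf_tm.simps)
  qed
  have wf_N: "wf_fm L ?N" using D(2) by (simp del: wf_fm.simps(4))
  \<comment> \<open>Under \<open>?N\<close>, assuming \<open>P\<close> gives \<open>?D\<close> and
    hence \<open>Bot\<close>; the resulting \<open>Neg P\<close> gives \<open>?D\<close> a second
    time.\<close>
  have "IL L MP_rules (P # ?N # \<Gamma>) P" using P wf_N \<Gamma> by (intro IL.hyp) simp_all
  then have "IL L MP_rules (P # ?N # \<Gamma>) ?D" using P by (intro IL.orI1) simp_all
  then have "IL L MP_rules (P # ?N # \<Gamma>) Bot" by (intro contra) simp
  then have "IL L MP_rules (?N # \<Gamma>) (Neg P)" by (rule IL.impI)
  then have "IL L MP_rules (?N # \<Gamma>) ?D" using P(2) by (rule IL.orI2)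
  then have "IL L MP_rules (?N # \<Gamma>) Bot" by (intro contra) simp
  moreover have "propositional (shift ?D)" using D(1) unfolding shift_def propositional_subst .
  moreover have "wf_fm L (shift ?D)" using D(2) unfolding wf_shift .
  ultimately have "IL L MP_rules \<Gamma> (Ex (shift ?D))" by (intro IL_MP_markov)
  \<comment> \<open>In \<open>exE\<close> the conclusion \<open>?D\<close> appears shifted, so it
    coincides with the witness hypothesis.\<close>
  moreover have "IL L MP_rules (shift ?D # map shift \<Gamma>) (shift ?D)"
    using D \<Gamma> by (intro IL.hyp) (simp_all del: wf_fm.simps)
  ultimately show ?thesis by (rule IL.exE)
qed

text \<open>The premises of \<open>EM\<^sub>1\<^sup>-\<close> occur as implications inside the formula, so that no weakening
  of their derivations is needed.\<close>

lemma IL_MP_EM1: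
  assumes P: "propositional P" "wf_fm L P" and Q: "propositional Q" "wf_fm L Q"
    and \<Gamma>: "list_all (wf_fm L) \<Gamma>"
  shows "IL L MP_rules \<Gamma>
    (Imp (Imp (All P) (Ex Q)) (Imp (Imp (Ex (Neg P)) (Ex Q)) (Ex Q)))"
proof -
  let ?N = "Neg (Ex Q)" and ?A = "Imp (All P) (Ex Q)" and ?E = "Imp (Ex (Neg P)) (Ex Q)"
  let ?\<Delta> = "?N # ?E # ?A # \<Gamma>"
  let ?\<Sigma> = "Neg P # map shift ?\<Delta>"
  have wf_\<Delta>: "list_all (wf_fm L) ?\<Delta>" using P Q \<Gamma> by simp
  then have wf_shift_\<Delta>: "list_all (wf_fm L) (map shift ?\<Delta>)"
    by (simp only: list_all_wf_shift)
  then have wf_\<Sigma>: "list_all (wf_fm L) ?\<Sigma>" using P by simp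
  \<comment> \<open>The eigenvariable \<open>Var 0\<close> of the coming \<open>allI\<close>
    witnesses the shifted \<open>Ex (Neg P)\<close>.\<close>
  have "IL L MP_rules ?\<Sigma> (inst (subst_fm (up (\<lambda>n. Var (Suc n))) (Neg P)) (Var 0))"
    using wf_\<Sigma> P by (subst inst_up_Suc_propositional) (auto intro!: IL.hyp)
  then have "IL L MP_rules ?\<Sigma> (Ex (subst_fm (up (\<lambda>n. Var (Suc n))) (Neg P)))"
    by (rule IL.exI) simp
  then have ex: "IL L MP_rules ?\<Sigma> (shift (Ex (Neg P)))" by (simp add: shift_def)
  have "IL L MP_rules ?\<Sigma> (shift ?E)" using wf_\<Sigma> by (rule IL.hyp) simp
  then have "IL L MP_rules ?\<Sigma> (Imp (shift (Ex (Neg P))) (shift (Ex Q)))"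
    by (simp add: shift_def)
  then have exQ: "IL L MP_rules ?\<Sigma> (shift (Ex Q))" using ex by (rule IL.impE)
  have "IL L MP_rules ?\<Sigma> (shift ?N)" using wf_\<Sigma> by (rule IL.hyp) simp
  then have "IL L MP_rules ?\<Sigma> (Neg (shift (Ex Q)))" by (simp add: shift_def)
  then have "IL L MP_rules ?\<Sigma> Bot" using exQ by (rule IL.impE)
  then have "IL L MP_rules ?\<Sigma> P" using P(2) by (rule IL_botE)
  moreover have "IL L MP_rules (P # map shift ?\<Delta>) P"
    using wf_shift_\<Delta> P by (intro IL.hyp) simp_all
  \<comment> \<open>Case distinction on the decidable \<open>P\<close>; the case
    \<open>Neg P\<close> was closed by ex falso.\<close>
  ultimately have "IL L MP_rules (map shift ?\<Delta>) P"
    using IL.orE[OF IL_MP_decidable[OF P wf_shift_\<Delta>]] by blast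
  then have "IL L MP_rules ?\<Delta> (All P)" by (rule IL.allI)
  moreover have "IL L MP_rules ?\<Delta> ?A" "IL L MP_rules ?\<Delta> ?N"
    using wf_\<Delta> by (auto intro: IL.hyp)
  ultimately have "IL L MP_rules ?\<Delta> Bot" by (blast intro: IL.impE)
  then show ?thesis using Q by (intro IL.impI IL_MP_markov)
qed

text \<open>Induction on the derivation: the logical rules are common to both systems, so only the
  instances of \<open>ext\<close> need to be simulated.\<close>

lemma IL_EM1_neg_imp_IL_MP:
  assumes "IL L (neg_axioms \<union> EM0_rules \<union> EM1_neg_rules) \<Gamma> A"
  shows "IL L MP_rules \<Gamma> A"
  using assms
proof (induction rule: IL.induct)
  case (ext ps \<Gamma> C)
  from ext.hyps(1) consider
      (ax) "(ps, \<Gamma>, C) \<in> neg_axioms"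
    | (EM0) "(ps, \<Gamma>, C) \<in> EM0_rules"
    | (EM1) "(ps, \<Gamma>, C) \<in> EM1_neg_rules"
    by blast
  then show ?case
  proof cases
    case ax
    then have "C \<in> set \<Gamma>" by (auto simp: neg_axioms_def)
    with ext.hyps show ?thesis by (blast intro: IL.hyp)
  next
    case EM0
    then obtain P where ps: "ps = [(Neg P # \<Gamma>, C), (P # \<Gamma>, C)]" and "propositional P"
      by (auto simp: EM0_rules_def neg_propositional_def)
    have prems: "IL L MP_rules (P # \<Gamma>) C" "IL L MP_rules (Neg P # \<Gamma>) C"
      using ext.IH by (simp_all add: ps)
    \<comment> \<open>\<open>P\<close> is absent from the conclusion of the rule, so its
      well-formedness is read off the context of a premise.\<close>
    then have "wf_fm L P" using IL_wf by fastforce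
    with \<open>propositional P\<close> have "IL L MP_rules \<Gamma> (Or P (Neg P))"
      using ext.hyps by (intro IL_MP_decidable)
    then show ?thesis using prems by (rule IL.orE)
  next
    case EM1
    then obtain P Q where ps: "ps = [(All P # \<Gamma>, Ex Q), (Ex (Neg P) # \<Gamma>, Ex Q)]"
      and C: "C = Ex Q" and "propositional P" "propositional Q"
      by (auto simp: EM1_neg_rules_def neg_propositional_def)
    have prems: "IL L MP_rules (All P # \<Gamma>) (Ex Q)" "IL L MP_rules (Ex (Neg P) # \<Gamma>) (Ex Q)"
      using ext.IH by (simp_all add: ps)
    then have "wf_fm L P" "wf_fm L Q" "list_all (wf_fm L) \<Gamma>" using IL_wf by fastforce+
    with \<open>propositional P\<close> \<open>propositional Q\<close> show ?thesis
      \<comment> \<open>Both premises become implications by \<open>impI\<close> and are fed to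
        \<open>IL_MP_EM1\<close> by \<open>impE\<close>.\<close>
      unfolding C using prems by (blast intro: IL_MP_EM1 IL.impE IL.impI)
  qed
qed (rule IL.intros; assumption)+

theorem theorem3p4:
  fixes L :: "('f, 'p) language" and F :: "('f, 'p) fm"
  assumes "wf_fm L F"
    and "provable_IL_EM1_neg L F"
  shows "provable_IL_MP L F"
  using assms(2) unfolding provable_IL_EM1_neg_def provable_IL_MP_def
  by (rule IL_EM1_neg_imp_IL_MP)

end
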